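(* Assume $\mathsf{CH}$. Then there are two sets of reals $A, B \subseteq \mathbb{R}$ that are homeomorphic (as subspaces of $\mathbb{R}$) such that $A$ is entangled but $B$ is not $2$-entangled (both with respect to the usual order of $\mathbb{R}$).
   Context: For a linear order $(L,\le)$ and two $n$-tuples $e,e'$ of elements of $L$, let $t(e,e') \in {}^n 2$ be defined by $t(e,e')_i = 1$ iff $e'_i < e_i$. For $t \in {}^n2$ let $\neg t = \langle 1-t_i \mid i<n\rangle$. Two $n$-tuples $e,e'$ realize $t$ if $t(e,e') = t$ or $t(e,e') = \neg t$. A tuple is 1-1 if its entries are pairwise distinct; two tuples are disjoint if they have no entry in common. For an infinite cardinal $\kappa$ and integer $n>0$, $L$ is $(\kappa,n)$-entangled if $|L| \ge \kappa$ and for every collection $F$ of size $\kappa$ of 1-1, mutually disjoint $n$-tuples of elements of $L$ and every $t \in {}^n2$, there are two distinct elements of $F$ that realize $t$. "$n$-entangled" means $(\aleph_1,n)$-entangled, and "entangled" means $n$-entangled for every $n>0$. *)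

theory Defs
  imports "HOL-Analysis.Analysis"
begin

unbundle cardinal_syntax

text \<open>
  Cardinals are represented, as in the library, by cardinal orders compared with
  \<open>=o\<close> and \<open>\<le>o\<close>, so that they may live on different types.
\<close>

definition aleph1 :: "nat set rel" where
  "aleph1 = cardSuc natLeq"

definition continuum_hypothesis :: bool where
  "continuum_hypothesis \<longleftrightarrow> |UNIV :: real set| =o aleph1"

text \<open>
  An \<open>n\<close>-tuple is a list of length \<open>n\<close>, and an element of \<open>\<^sup>n2\<close> is a Boolean list of
  length \<open>n\<close>, with \<open>True\<close> for 1. Hence \<open>\<not>t\<close> is \<open>map Not t\<close>.
\<close>

definition tuple_type :: "'a::linorder list \<Rightarrow> 'a list \<Rightarrow> bool list" where
  "tuple_type e e' = map2 (\<lambda>x y. y < x) e e'"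

definition realize :: "'a::linorder list \<Rightarrow> 'a list \<Rightarrow> bool list \<Rightarrow> bool" where
  "realize e e' t \<longleftrightarrow> tuple_type e e' = t \<or> tuple_type e e' = map Not t"

text \<open>
  \<open>L\<close> carries the order inherited from its type. The notion is intended for \<open>\<kappa>\<close> an
  infinite cardinal (\<open>Card_order \<kappa>\<close> and \<open>cinfinite \<kappa>\<close>) and \<open>n > 0\<close>.
\<close>

definition card_entangled :: "'k rel \<Rightarrow> nat \<Rightarrow> 'a::linorder set \<Rightarrow> bool" where
  "card_entangled \<kappa> n L \<longleftrightarrow>
     \<kappa> \<le>o |L| \<and>
     (\<forall>F t. |F| =o \<kappa> \<and>
        (\<forall>e\<in>F. length e = n \<and> set e \<subseteq> L \<and> distinct e) \<and>
        pairwise (\<lambda>e e'. set e \<inter> set e' = {}) F \<and>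
        length t = n \<longrightarrow>
        (\<exists>e\<in>F. \<exists>e'\<in>F. e \<noteq> e' \<and> realize e e' t))"

definition n_entangled :: "nat \<Rightarrow> 'a::linorder set \<Rightarrow> bool" where
  "n_entangled n L \<longleftrightarrow> card_entangled aleph1 n L"

definition entangled :: "'a::linorder set \<Rightarrow> bool" where
  "entangled L \<longleftrightarrow> (\<forall>n>0. n_entangled n L)"

end

theory Submission
  imports Defs "HOL-Library.Countable_Set_Type"
begin

text \<open>
  Let \<open>\<phi>\<close> be a homeomorphism of Cantor space that flips every other digit, so that in the
  lexicographic order it is monotone on no open set. For a set \<open>X\<close> of points, \<open>B\<close>
  consists of two order-isomorphic copies of \<open>X\<close> placed one after the other, whereas in \<open>A\<close> the
  second copy is \<open>\<phi> ` X\<close>. Then \<open>A\<close> and \<open>B\<close> are homeomorphic, and the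
  pairs of corresponding points show that \<open>B\<close> is not 2-entangled. With CH, \<open>X\<close> is
  chosen as a Luzin-type set: each point is Cohen generic over the countably many closed
  sets of tuples enumerated before it, with the earlier points as parameters. If a tuple of late
  points of \<open>X\<close> lies in the closure of an uncountable family, then the closure contains a
  box around the tuple, and inside a box every order type is realized because \<open>\<phi>\<close> is
  nowhere monotone.
\<close>

subsection \<open>Binary sequences\<close>

definition seg :: "nat \<Rightarrow> (nat \<Rightarrow> 'a) \<Rightarrow> 'a list" where
  "seg m x = map x [0..<m]"

definition cyl :: "'a list \<Rightarrow> (nat \<Rightarrow> 'a) set" where
  "cyl l = {x. seg (length l) x = l}"

lemma length_seg [simp]: "length (seg m x) = m"
  by (simp add: seg_def)

lemma seg_eq_iff: "seg m x = seg m y \<longleftrightarrow> (\<forall>k<m. x k = y k)"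
  by (auto simp: seg_def list_eq_iff_nth_eq)

lemma take_seg: "m \<le> n \<Longrightarrow> take m (seg n x) = seg m x"
  by (simp add: seg_def take_map)

lemma mem_cyl_seg: "y \<in> cyl (seg m x) \<longleftrightarrow> (\<forall>k<m. y k = x k)"
  by (simp add: cyl_def seg_eq_iff)

lemma cyl_append_subset: "cyl (l @ u) \<subseteq> cyl l"
proof
  fix x assume "x \<in> cyl (l @ u)"
  then have "take (length l) (seg (length l + length u) x) = l"
    by (simp add: cyl_def)
  then show "x \<in> cyl l"
    by (simp add: take_seg cyl_def)
qed

lemma first_difference:
  fixes k :: nat
  assumes "x k \<noteq> y k"
  shows "\<exists>j. x j \<noteq> y j \<and> (\<forall>i<j. x i = y i) \<and> j \<le> k"
  using assms LeastI[of "\<lambda>k. x k \<noteq> y k" k] Least_le[of "\<lambda>k. x k \<noteq> y k" k]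
    not_less_Least[of _ "\<lambda>k. x k \<noteq> y k"]
  by (intro exI[of _ "LEAST k. x k \<noteq> y k"]) blast

text \<open>Genericity of \<open>x\<close> with respect to a closed \<open>S\<close>:
  \<open>x\<close> is not a boundary point. The case \<open>x \<notin> S\<close> imposes nothing,
  since closedness already gives a cylinder around \<open>x\<close> that misses
  \<open>S\<close>.\<close>

definition decides :: "(nat \<Rightarrow> 'a) \<Rightarrow> (nat \<Rightarrow> 'a) set \<Rightarrow> bool" where
  "decides x S \<longleftrightarrow> (x \<in> S \<longrightarrow> (\<exists>m. cyl (seg m x) \<subseteq> S))"

definition seq_closed :: "(nat \<Rightarrow> 'a) set \<Rightarrow> bool" where
  "seq_closed S \<longleftrightarrow> (\<forall>x. x \<notin> S \<longrightarrow> (\<exists>m. cyl (seg m x) \<inter> S = {}))"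

text \<open>Either \<open>cyl l\<close> lies in \<open>S\<close>, or a point of \<open>cyl l\<close>
  outside \<open>S\<close> has a cylinder missing \<open>S\<close>. Demanding
  \<open>u \<noteq> []\<close> makes iterated extensions converge to an infinite sequence.\<close>

lemma extend_to_decide:
  assumes "seq_closed S"
  shows "\<exists>u. u \<noteq> [] \<and> (cyl (l @ u) \<subseteq> S \<or> cyl (l @ u) \<inter> S = {})"
proof (cases "cyl l \<subseteq> S")
  case True
  then show ?thesis
    using cyl_append_subset[of l "[undefined]"] by blast
next
  case False
  then obtain x where x: "x \<in> cyl l" "x \<notin> S"
    by blast
  then obtain m where m: "cyl (seg m x) \<inter> S = {}"
    using assms by (auto simp: seq_closed_def)
  define n where "n = Suc (m + length l)"
  have "take (length l) (seg n x) = l"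
    using x(1) by (simp add: n_def take_seg cyl_def)
  then have eq: "l @ drop (length l) (seg n x) = seg n x"
    by (metis append_take_drop_id)
  have "cyl (seg n x) \<subseteq> cyl (seg m x)"
    by (auto simp: mem_cyl_seg n_def)
  moreover have "drop (length l) (seg n x) \<noteq> []"
    by (simp add: n_def)
  ultimately show ?thesis
    using m eq by (intro exI[of _ "drop (length l) (seg n x)"]) auto
qed

text \<open>A Baire category argument: the boundary of a closed set is nowhere dense, so countably
  many boundaries can be avoided by extending a finite sequence step by step.\<close>

lemma ex_decides_countable:
  assumes "countable \<S>" and closed: "\<And>S. S \<in> \<S> \<Longrightarrow> seq_closed S"
  shows "\<exists>x :: nat \<Rightarrow> 'a. \<forall>S\<in>\<S>. decides x S"
proof (cases "\<S> = {}")
  case False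
  define T where "T = from_nat_into \<S>"
  have T: "seq_closed (T n)" for n
    using closed False by (simp add: T_def from_nat_into)
  define Q where "Q n l l' \<longleftrightarrow> (\<exists>u. u \<noteq> [] \<and> l' = l @ u) \<and> (cyl l' \<subseteq> T n \<or> cyl l' \<inter> T n = {})"
    for n and l l' :: "'a list"
  have "\<exists>l'. True \<and> Q n l l'" for n l
    using extend_to_decide[OF T, of l n] by (auto simp: Q_def)
  then have "\<exists>s. \<forall>n. True \<and> Q n (s n) (s (Suc n))"
    using dependent_nat_choice[of "\<lambda>_ _. True" Q] by simp
  then obtain s where Q: "\<And>n. Q n (s n) (s (Suc n))"
    by blast
  then have s: "\<exists>u. u \<noteq> [] \<and> s (Suc n) = s n @ u" for n
    by (simp add: Q_def)
  have dec: "cyl (s (Suc n)) \<subseteq> T n \<or> cyl (s (Suc n)) \<inter> T n = {}" for n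
    using Q[of n] by (simp add: Q_def)
  have len: "n \<le> length (s n)" for n
  proof (induction n)
    case (Suc n)
    obtain u where "u \<noteq> []" "s (Suc n) = s n @ u"
      using s by blast
    with Suc show ?case
      by (cases u) auto
  qed simp
  have pre: "\<exists>u. s (n + k) = s n @ u" for n k
  proof (induction k)
    case (Suc k)
    then show ?case
      using s[of "n + k"] by auto
  qed simp
  \<comment> \<open>By \<open>len\<close>, \<open>s (Suc k)\<close> has length at least
    \<open>Suc k\<close>, so entry \<open>k\<close> exists.\<close>
  define x where "x k = s (Suc k) ! k" for k
  have nth: "s n ! k = x k" if "k < length (s n)" for n k
  proof (cases "n \<le> Suc k")
    case True
    then obtain u where "s (Suc k) = s n @ u"
      using pre[of n "Suc k - n"] by auto
    with that show ?thesis
      by (simp add: x_def nth_append)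
  next
    case False
    then obtain u where "s n = s (Suc k) @ u"
      using pre[of "Suc k" "n - Suc k"] by auto
    with len[of "Suc k"] show ?thesis
      by (simp add: x_def nth_append)
  qed
  have seg: "seg (length (s n)) x = s n" for n
    by (rule nth_equalityI) (simp_all add: nth seg_def)
  have x_cyl: "x \<in> cyl (s n)" for n
    by (simp add: cyl_def seg)
  have "decides x S" if "S \<in> \<S>" for S
  proof -
    obtain n where "S = T n"
      using from_nat_into_surj[OF assms(1) \<open>S \<in> \<S>\<close>] by (auto simp: T_def)
    moreover have "cyl (seg (length (s (Suc n))) x) \<subseteq> S" if "x \<in> S"
      using dec[of n] x_cyl[of "Suc n"] seg[of "Suc n"] that \<open>S = T n\<close> by auto
    ultimately show ?thesis
      unfolding decides_def by blast
  qed
  then show ?thesis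
    by blast
qed simp

text \<open>No cylinder of Cantor space is a single point. Deciding the singletons of earlier points
  therefore forces a new point to differ from them.\<close>

lemma not_decides_singleton: "\<not> decides x {x :: nat \<Rightarrow> bool}"
proof
  assume "decides x {x}"
  then obtain m where "cyl (seg m x) \<subseteq> {x}"
    by (auto simp: decides_def)
  moreover have "x(m := \<not> x m) \<in> cyl (seg m x)"
    by (simp add: mem_cyl_seg)
  ultimately have "x(m := \<not> x m) = x"
    by blast
  then show False
    by (metis fun_upd_same)
qed

lemma seq_closed_singleton: "seq_closed {x}"
proof -
  have "\<exists>m. cyl (seg m y) \<inter> {x} = {}" if "y \<noteq> x" for y
  proof -
    obtain k where "y k \<noteq> x k"
      using \<open>y \<noteq> x\<close> by (auto simp: fun_eq_iff)
    then have "x \<notin> cyl (seg (Suc k) y)"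
      by (auto simp: mem_cyl_seg)
    then show ?thesis
      by blast
  qed
  then show ?thesis
    by (simp add: seq_closed_def)
qed

subsection \<open>Binary sequences as reals\<close>

text \<open>
  Base 3 with digits 0 and 1 makes the tail strictly smaller than a unit of the
  preceding digit, so that the map is injective and preserves the lexicographic order.
\<close>

definition ternary :: "(nat \<Rightarrow> bool) \<Rightarrow> real" where
  "ternary x = (\<Sum>k. of_bool (x k) * (1/3) ^ k)"

lemma summable_ternary: "summable (\<lambda>k. of_bool (x k) * (1/3 :: real) ^ k)"
  by (rule summable_comparison_test'[where g = "\<lambda>k. (1/3) ^ k" and N = 0])
     (auto intro: summable_geometric)

lemma ternary_nonneg: "0 \<le> ternary x"
  unfolding ternary_def by (rule suminf_nonneg[OF summable_ternary]) simp

lemma ternary_le: "ternary x \<le> 3/2"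
proof -
  have "ternary x \<le> (\<Sum>k. (1/3) ^ k)"
    unfolding ternary_def by (intro suminf_le summable_ternary summable_geometric) auto
  also have "\<dots> = 3/2"
    by (subst suminf_geometric) auto
  finally show ?thesis .
qed

lemma ternary_head: "ternary x = of_bool (x 0) + ternary (\<lambda>k. x (Suc k)) / 3"
proof -
  have "ternary x = (\<Sum>k. of_bool (x (Suc k)) * (1/3) ^ Suc k) + of_bool (x 0) * (1/3) ^ 0"
    unfolding ternary_def by (subst suminf_split_head[OF summable_ternary]) simp
  also have "(\<Sum>k. of_bool (x (Suc k)) * (1/3 :: real) ^ Suc k) =
      (\<Sum>k. of_bool (x (Suc k)) * (1/3) ^ k * (1/3))"
    by (simp add: ac_simps)
  also have "\<dots> = ternary (\<lambda>k. x (Suc k)) * (1/3)"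
    unfolding ternary_def by (rule suminf_mult2[OF summable_ternary, symmetric])
  finally show ?thesis
    by simp
qed

lemma ternary_diff_le:
  assumes "\<forall>k<m. x k = y k"
  shows "\<bar>ternary x - ternary y\<bar> \<le> 3/2 * (1/3) ^ m"
  using assms
proof (induction m arbitrary: x y)
  case 0
  then show ?case
    using ternary_nonneg[of x] ternary_nonneg[of y] ternary_le[of x] ternary_le[of y]
    by (auto simp: abs_if)
next
  case (Suc m)
  have "\<bar>ternary (\<lambda>k. x (Suc k)) - ternary (\<lambda>k. y (Suc k))\<bar> \<le> 3/2 * (1/3) ^ m"
    using Suc.prems by (intro Suc.IH) auto
  moreover have "x 0 = y 0"
    using Suc.prems by simp
  ultimately show ?case
    using ternary_head[of x] ternary_head[of y] by (auto simp: abs_if split: if_splits)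
qed

lemma ternary_diff_ge:
  assumes "\<forall>k<m. x k = y k" and "\<not> x m" and "y m"
  shows "ternary x + 1/2 * (1/3) ^ m \<le> ternary y"
  using assms
proof (induction m arbitrary: x y)
  case 0
  then show ?case
    using ternary_head[of x] ternary_head[of y] ternary_le[of "\<lambda>k. x (Suc k)"]
      ternary_nonneg[of "\<lambda>k. y (Suc k)"] by simp
next
  case (Suc m)
  have "ternary (\<lambda>k. x (Suc k)) + 1/2 * (1/3) ^ m \<le> ternary (\<lambda>k. y (Suc k))"
    using Suc.prems by (intro Suc.IH) auto
  moreover have "x 0 = y 0"
    using Suc.prems by simp
  ultimately show ?case
    using ternary_head[of x] ternary_head[of y] by simp
qed

lemma ternary_less:
  assumes "\<forall>k<m. x k = y k" and "\<not> x m" and "y m"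
  shows "ternary x < ternary y"
proof -
  have "0 < 1/2 * (1/3 :: real) ^ m"
    by simp
  with ternary_diff_ge[OF assms] show ?thesis
    by linarith
qed

text \<open>The first difference dominates the distance. Together with
  \<open>ternary_diff_le\<close>, closeness of the reals and agreement of initial digits control
  each other uniformly.\<close>

lemma ternary_dist_ge:
  assumes "k < m" and "x k \<noteq> y k"
  shows "1/2 * (1/3) ^ m \<le> \<bar>ternary x - ternary y\<bar>"
proof -
  obtain j where j: "x j \<noteq> y j" "\<forall>i<j. x i = y i" "j \<le> k"
    using first_difference[of x k y, OF assms(2)] by (elim exE conjE)
  have "(1/3 :: real) ^ m \<le> (1/3) ^ j"
    using j(3) assms(1) by (intro power_decreasing) auto
  moreover have "1/2 * (1/3) ^ j \<le> \<bar>ternary x - ternary y\<bar>"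
  proof (cases "x j")
    case True
    then show ?thesis
      using ternary_diff_ge[of j y x] j by (auto simp: abs_if)
  next
    case False
    then show ?thesis
      using ternary_diff_ge[of j x y] j by (auto simp: abs_if)
  qed
  ultimately show ?thesis
    by linarith
qed

lemma inj_ternary: "inj ternary"
proof (rule injI, rule ext, rule ccontr)
  fix x y k assume "ternary x = ternary y" "x k \<noteq> y k"
  then have "1/2 * (1/3 :: real) ^ Suc k \<le> 0"
    using ternary_dist_ge[of k "Suc k" x y] by simp
  moreover have "0 < (1/3 :: real) ^ Suc k"
    by (rule zero_less_power) simp
  ultimately show False
    by linarith
qed

section \<open>Homeomorphisms between sets with a common parametrization\<close>

lemma ex_continuous_factor:
  fixes f g :: "'a \<Rightarrow> 'b :: metric_space"
  assumes fg: "\<And>e. e > 0 \<Longrightarrow> \<exists>d>0. \<forall>u v. dist (f u) (f v) < d \<longrightarrow> dist (g u) (g v) < e"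
  shows "\<exists>h. (\<forall>u. h (f u) = g u) \<and> continuous_on (range f) h"
proof -
  define h where "h a = g (SOME u. f u = a)" for a
  \<comment> \<open>The modulus makes \<open>g\<close> constant on the fibers of \<open>f\<close>,
    so the choice in \<open>h\<close> does not matter.\<close>
  have eq: "g v = g u" if "f v = f u" for u v
  proof (rule ccontr)
    assume "g v \<noteq> g u"
    then have pos: "0 < dist (g v) (g u)"
      by simp
    obtain d where "d > 0" and d: "\<forall>u' v'. dist (f u') (f v') < d \<longrightarrow> dist (g u') (g v') < dist (g v) (g u)"
      using fg[OF pos] by (elim exE conjE)
    from d[rule_format, of v u] \<open>d > 0\<close> that show False
      by simp
  qed
  have h: "h (f u) = g u" for u
    unfolding h_def by (rule eq, rule someI[of "\<lambda>v. f v = f u" u]) (rule refl)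
  have "continuous_on (range f) h"
    unfolding continuous_on_iff
  proof (intro ballI allI impI)
    fix a and e :: real
    assume "a \<in> range f" "0 < e"
    then obtain u where a: "a = f u"
      by blast
    obtain d where "d > 0" "\<forall>u v. dist (f u) (f v) < d \<longrightarrow> dist (g u) (g v) < e"
      using fg[OF \<open>0 < e\<close>] by (elim exE conjE)
    then show "\<exists>d>0. \<forall>a'\<in>range f. dist a' a < d \<longrightarrow> dist (h a') (h a) < e"
      by (intro exI[of _ d]) (simp add: h a)
  qed
  with h show ?thesis
    by blast
qed

lemma homeomorphic_images:
  fixes f g :: "'a \<Rightarrow> 'b :: metric_space"
  assumes "\<And>e. e > 0 \<Longrightarrow> \<exists>d>0. \<forall>u v. dist (f u) (f v) < d \<longrightarrow> dist (g u) (g v) < e"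
    and "\<And>e. e > 0 \<Longrightarrow> \<exists>d>0. \<forall>u v. dist (g u) (g v) < d \<longrightarrow> dist (f u) (f v) < e"
  shows "range f homeomorphic range g"
proof -
  obtain h where h: "\<And>u. h (f u) = g u" "continuous_on (range f) h"
    using ex_continuous_factor[OF assms(1)] by blast
  obtain h' where h': "\<And>u. h' (g u) = f u" "continuous_on (range g) h'"
    using ex_continuous_factor[OF assms(2)] by blast
  show ?thesis
    by (rule homeomorphicI[of h _ _ h']) (use h h' in \<open>auto simp: image_image\<close>)
qed

text \<open>Agreement of the first \<open>m\<close> digits is, up to constants, distance below
  \<open>(1/3) ^ m\<close>; equal agreement for \<open>p\<close> and \<open>q\<close> thus gives
  uniform moduli in both directions.\<close>

lemma homeomorphic_ternary_images:
  assumes "\<And>m u v. (\<forall>k<m. p u k = p v k) \<longleftrightarrow> (\<forall>k<m. q u k = q v k)"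
  shows "range (\<lambda>u. ternary (p u)) homeomorphic range (\<lambda>u. ternary (q u))"
proof -
  have *: "\<exists>d>0. \<forall>u v. dist (ternary (p u)) (ternary (p v)) < d \<longrightarrow> dist (ternary (q u)) (ternary (q v)) < e"
    if agree: "\<And>m u v. (\<forall>k<m. p u k = p v k) \<longrightarrow> (\<forall>k<m. q u k = q v k)" and "0 < e"
    for e :: real and p q :: "'a \<Rightarrow> nat \<Rightarrow> bool"
  proof -
    obtain m where m: "(1/3) ^ m < 2/3 * e"
      using real_arch_pow_inv[of "2/3 * e" "1/3"] \<open>0 < e\<close> by auto
    have "dist (ternary (q u)) (ternary (q v)) < e"
      if "dist (ternary (p u)) (ternary (p v)) < 1/2 * (1/3) ^ m" for u v
    proof -
      have "\<forall>k<m. p u k = p v k"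
        using that ternary_dist_ge[of _ m "p u" "p v"] by (force simp: dist_real_def)
      with agree have "\<bar>ternary (q u) - ternary (q v)\<bar> \<le> 3/2 * (1/3) ^ m"
        by (intro ternary_diff_le) blast
      with m show ?thesis
        by (simp add: dist_real_def)
    qed
    then show ?thesis
      by (intro exI[of _ "1/2 * (1/3) ^ m"]) auto
  qed
  show ?thesis
    by (rule homeomorphic_images; rule *) (simp_all add: assms)
qed

subsection \<open>Closed sets of tuples\<close>

text \<open>A closed set of tuples is coded by finite approximations. For binary sequences the codes
  are subsets of a countable type, so the reals can enumerate them.\<close>

definition tuples_of :: "'a list list set \<Rightarrow> (nat \<Rightarrow> 'a) list set" where
  "tuples_of T = {g. \<forall>m. map (seg m) g \<in> T}"

definition tuple_box :: "'a set list \<Rightarrow> 'a list set" where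
  "tuple_box Bs = {g. list_all2 (\<in>) g Bs}"

text \<open>An intersection of one-dimensional sections of the closed set. Quantifying over whole
  boxes lets one condition on \<open>z\<close> speak of coordinates already widened to cylinders as
  well as of fixed parameters.\<close>

definition slice :: "'a list list set \<Rightarrow> (nat \<Rightarrow> 'a) set list \<Rightarrow> (nat \<Rightarrow> 'a) set list \<Rightarrow> (nat \<Rightarrow> 'a) set" where
  "slice T Bs Cs = {z. \<forall>g\<in>tuple_box Bs. \<forall>h\<in>tuple_box Cs. g @ z # h \<in> tuples_of T}"

definition sides :: "(nat \<Rightarrow> 'a) set \<Rightarrow> (nat \<Rightarrow> 'a) set set" where
  "sides W = range cyl \<union> (\<lambda>y. {y}) ` W"

lemma countable_sides: "countable W \<Longrightarrow> countable (sides W :: (nat \<Rightarrow> 'a :: countable) set set)"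
  by (simp add: sides_def)

lemma tuple_box_append_Cons:
  "f \<in> tuple_box (Bs @ B # Cs) \<longleftrightarrow> (\<exists>g z h. f = g @ z # h \<and> g \<in> tuple_box Bs \<and> z \<in> B \<and> h \<in> tuple_box Cs)"
  unfolding tuple_box_def mem_Collect_eq
proof
  assume "list_all2 (\<in>) f (Bs @ B # Cs)"
  then show "\<exists>g z h. f = g @ z # h \<and> list_all2 (\<in>) g Bs \<and> z \<in> B \<and> list_all2 (\<in>) h Cs"
    by (auto simp: list_all2_append2 list_all2_Cons2)
next
  assume "\<exists>g z h. f = g @ z # h \<and> list_all2 (\<in>) g Bs \<and> z \<in> B \<and> list_all2 (\<in>) h Cs"
  then show "list_all2 (\<in>) f (Bs @ B # Cs)"
    by (elim exE conjE) (simp add: list_all2_appendI)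
qed

lemma tuple_box_mono:
  assumes "list_all2 (\<subseteq>) Bs Cs"
  shows "tuple_box Bs \<subseteq> tuple_box Cs"
  unfolding tuple_box_def using list_all2_trans[OF _ _ assms, of "(\<in>)" "(\<in>)"] by blast

lemma tuple_box_singletons: "tuple_box (map (\<lambda>r. {f r}) rs) = {map f rs}"
proof -
  have "list_all2 (\<in>) g (map (\<lambda>r. {f r}) rs) \<longleftrightarrow> list_all2 (=) g (map f rs)" for g
    by (simp add: list_all2_map2)
  then show ?thesis
    by (auto simp: tuple_box_def list.rel_eq)
qed

lemma seq_closed_slice: "seq_closed (slice T Bs Cs)"
  unfolding seq_closed_def
proof (intro allI impI)
  fix z assume "z \<notin> slice T Bs Cs"
  then obtain g h m where gh: "g \<in> tuple_box Bs" "h \<in> tuple_box Cs" "map (seg m) (g @ z # h) \<notin> T"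
    unfolding slice_def tuples_of_def by blast
  have "y \<notin> slice T Bs Cs" if "y \<in> cyl (seg m z)" for y
  proof -
    have "seg m y = seg m z"
      using that by (simp add: mem_cyl_seg seg_eq_iff)
    with gh(3) have "g @ y # h \<notin> tuples_of T"
      unfolding tuples_of_def mem_Collect_eq list.map map_append by metis
    with gh(1,2) show ?thesis
      by (auto simp: slice_def)
  qed
  then show "\<exists>m. cyl (seg m z) \<inter> slice T Bs Cs = {}"
    by blast
qed

text \<open>The Luzin-type property: \<open>x r\<close> is generic over every closed set coded at an
  earlier index, with cylinders and earlier points as parameters. Lists of arbitrary length treat
  tuples of all sizes at once.\<close>

locale generic_sequence = linorder le lt
  for le lt :: "'i \<Rightarrow> 'i \<Rightarrow> bool" +
  fixes c :: "'i \<Rightarrow> bool list list set" and x :: "'i \<Rightarrow> nat \<Rightarrow> bool"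
  assumes countable_below: "countable {s. lt s r}"
    and surj_c: "surj c"
    and inj_x: "inj x"
    and decides_slice: "\<lbrakk>lt s r; set Bs \<subseteq> sides (x ` {s. lt s r}); set Cs \<subseteq> sides (x ` {s. lt s r})\<rbrakk>
      \<Longrightarrow> decides (x r) (slice (c s) Bs Cs)"
begin

text \<open>
  The singleton sides of the box are widened to cylinders one at a time. Since \<open>rs\<close> is
  decreasing, the coordinate being widened is later than all remaining singletons, so it
  is generic over the data defining its slice.
\<close>

lemma tuple_box_subset_tuples_of:
  assumes sorted: "sorted_wrt (\<lambda>r s. lt s r) rs"
    and later: "\<And>r. r \<in> set rs \<Longrightarrow> lt s r"
    and mem: "map x rs \<in> tuples_of (c s)"
  shows "\<exists>m. tuple_box (map (\<lambda>r. cyl (seg m (x r))) rs) \<subseteq> tuples_of (c s)"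
proof -
  \<comment> \<open>Stage \<open>n\<close> of the widening: the \<open>n\<close> latest coordinates
    range over cylinders, the others are still fixed.\<close>
  have "\<exists>m. tuple_box (map (\<lambda>r. cyl (seg m (x r))) (take n rs) @ map (\<lambda>r. {x r}) (drop n rs)) \<subseteq> tuples_of (c s)"
    if "n \<le> length rs" for n
    using that
  proof (induction n)
    case 0
    then show ?case
      using mem by (simp add: tuple_box_singletons)
  next
    case (Suc n)
    define r us where "r = rs ! n" and "us = drop (Suc n) rs"
    have n: "n < length rs"
      using Suc.prems by simp
    then have split: "drop n rs = r # us" "take (Suc n) rs = take n rs @ [r]"
      by (simp_all add: r_def us_def Cons_nth_drop_Suc take_Suc_conv_app_nth)
    define Bs where "Bs m = map (\<lambda>r. cyl (seg m (x r))) (take n rs)" for m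
    define Cs where "Cs = map (\<lambda>r. {x r}) us"
    obtain m where m: "tuple_box (Bs m @ {x r} # Cs) \<subseteq> tuples_of (c s)"
      using Suc unfolding Bs_def Cs_def split by auto
    have "sorted_wrt (\<lambda>r s. lt s r) (r # us)"
      using sorted by (metis split(1) sorted_wrt_drop)
    then have Cs: "set Cs \<subseteq> sides (x ` {s. lt s r})"
      by (auto simp: Cs_def sides_def)
    have Bs: "set (Bs m) \<subseteq> sides (x ` {s. lt s r})"
      by (auto simp: Bs_def sides_def)
    have "lt s r"
      using later n by (simp add: r_def)
    from decides_slice[OF this Bs Cs] have "decides (x r) (slice (c s) (Bs m) Cs)" .
    moreover have "x r \<in> slice (c s) (Bs m) Cs"
      using m by (auto simp: slice_def intro!: subsetD[OF m] tuple_box_append_Cons[THEN iffD2])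
    ultimately obtain l where l: "cyl (seg l (x r)) \<subseteq> slice (c s) (Bs m) Cs"
      by (auto simp: decides_def)
    \<comment> \<open>The depth \<open>m + l\<close> refines both the old depth \<open>m\<close> and
      the depth \<open>l\<close> obtained from genericity, so one depth serves all widened
      coordinates.\<close>
    have "tuple_box (Bs (m + l) @ cyl (seg (m + l) (x r)) # Cs) \<subseteq> tuple_box (Bs m @ cyl (seg l (x r)) # Cs)"
    proof (rule tuple_box_mono, rule list_all2_appendI)
      show "list_all2 (\<subseteq>) (Bs (m + l)) (Bs m)"
        by (auto simp: Bs_def list_all2_conv_all_nth mem_cyl_seg)
      show "list_all2 (\<subseteq>) (cyl (seg (m + l) (x r)) # Cs) (cyl (seg l (x r)) # Cs)"
        by (auto simp: list_all2_conv_all_nth mem_cyl_seg nth_Cons split: nat.split)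
    qed
    also have "\<dots> \<subseteq> tuples_of (c s)"
      using l by (force simp: slice_def tuple_box_append_Cons)
    finally show ?case
      unfolding Bs_def Cs_def split by (intro exI[of _ "m + l"]) (simp add: us_def)
  qed
  from this[of "length rs"] show ?thesis
    by simp
qed

end

text \<open>Well-founded recursion: stage \<open>r\<close> has only countably many requirements,
  because there are countably many earlier indices, and these can be met simultaneously.\<close>

lemma ex_generic_sequence:
  fixes le lt :: "'i \<Rightarrow> 'i \<Rightarrow> bool"
  assumes lin: "class.linorder le lt" and wf: "wf {(s, r). lt s r}"
    and countable_below: "\<And>r. countable {s. lt s r}"
    and surj_c: "surj (c :: 'i \<Rightarrow> bool list list set)"
  shows "\<exists>x. generic_sequence le lt c x"
proof -
  interpret linorder le lt
    by (rule lin)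
  \<comment> \<open>Besides the slices, the singletons of earlier points are included to make
    \<open>x\<close> injective.\<close>
  define \<S> where "\<S> x r = (\<lambda>(s, Bs, Cs). slice (c s) Bs Cs) `
      ({s. lt s r} \<times> lists (sides (x ` {s. lt s r})) \<times> lists (sides (x ` {s. lt s r})))
      \<union> (\<lambda>s. {x s}) ` {s. lt s r}" for x :: "'i \<Rightarrow> nat \<Rightarrow> bool" and r
  have "\<exists>x. \<forall>r. \<forall>S \<in> \<S> x r. decides (x r) S"
  proof (rule dependent_wf_choice[OF wf, where P = "\<lambda>x r z. \<forall>S \<in> \<S> x r. decides z S"])
    \<comment> \<open>The recursion principle needs the requirements at \<open>r\<close> to depend
      only on values below \<open>r\<close>.\<close>
    fix f g :: "'i \<Rightarrow> nat \<Rightarrow> bool" and r z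
    assume "\<And>s. (s, r) \<in> {(s, r). lt s r} \<Longrightarrow> f s = g s"
    then have "f ` {s. lt s r} = g ` {s. lt s r}" "(\<lambda>s. {f s}) ` {s. lt s r} = (\<lambda>s. {g s}) ` {s. lt s r}"
      by (auto intro!: image_cong)
    then show "(\<forall>S \<in> \<S> f r. decides z S) = (\<forall>S \<in> \<S> g r. decides z S)"
      by (simp add: \<S>_def)
  next
    fix r and f :: "'i \<Rightarrow> nat \<Rightarrow> bool"
    show "\<exists>z. \<forall>S \<in> \<S> f r. decides z S"
    proof (rule ex_decides_countable)
      show "countable (\<S> f r)"
        unfolding \<S>_def using countable_below
        by (intro countable_Un countable_image countable_SIGMA countable_lists countable_sides)
      show "seq_closed S" if "S \<in> \<S> f r" for S
        using that by (auto simp: \<S>_def intro: seq_closed_slice seq_closed_singleton)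
    qed
  qed
  then obtain x where x: "\<And>r S. S \<in> \<S> x r \<Longrightarrow> decides (x r) S"
    by blast
  have new: "x s \<noteq> x r" if "lt s r" for s r
    using x[of "{x s}" r] not_decides_singleton[of "x r"] that by (auto simp: \<S>_def)
  then have inj: "inj x"
    by (metis injI neq_iff)
  have "decides (x r) (slice (c s) Bs Cs)"
    if "lt s r" "set Bs \<subseteq> sides (x ` {s. lt s r})" "set Cs \<subseteq> sides (x ` {s. lt s r})" for s r Bs Cs
    by (rule x) (use that in \<open>force simp: \<S>_def in_lists_conv_set\<close>)
  with lin countable_below surj_c inj have "generic_sequence le lt c x"
    by (intro generic_sequence.intro generic_sequence_axioms.intro)
  then show ?thesis
    by (rule exI[of "generic_sequence le lt c"])
qed

subsection \<open>Entangledness of the twisted set\<close>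

text \<open>
  Flipping the odd bits after the leading \<open>True\<close> makes the second half of the set a
  nowhere monotone homeomorphic copy of the first.
\<close>

definition twist :: "bool \<Rightarrow> (nat \<Rightarrow> bool) \<Rightarrow> nat \<Rightarrow> bool" where
  "twist b z = case_nat b (\<lambda>k. z k \<noteq> (b \<and> odd k))"

lemma agree_case_nat:
  "(\<forall>k<m. case_nat b y k = case_nat d z k) \<longleftrightarrow> (0 < m \<longrightarrow> b = d) \<and> (\<forall>k. Suc k < m \<longrightarrow> y k = z k)"
  by (cases m) (simp_all add: All_less_Suc2)

text \<open>Which positions are flipped depends only on the leading bit, so sequences agreeing in
  that bit undergo the same flips. This is the source of the homeomorphism.\<close>

lemma agree_twist:
  "(\<forall>k<m. twist b y k = twist d z k) \<longleftrightarrow> (\<forall>k<m. case_nat b y k = case_nat d z k)"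
  by (cases m) (auto simp: agree_case_nat twist_def)

lemma ternary_twist_inject [simp]: "ternary (twist b y) = ternary (twist d z) \<longleftrightarrow> b = d \<and> y = z"
proof
  assume "ternary (twist b y) = ternary (twist d z)"
  then have "\<And>k. twist b y k = twist d z k"
    using inj_ternary by (simp add: inj_eq)
  then have "\<And>m. \<forall>k<m. case_nat b y k = case_nat d z k"
    using agree_twist by blast
  then show "b = d \<and> y = z"
    by (auto simp: agree_case_nat fun_eq_iff)
qed simp

lemma ternary_case_nat_less_iff:
  assumes "\<forall>k<m. y k = z k" and "y m \<noteq> z m"
  shows "ternary (case_nat b y) < ternary (case_nat b z) \<longleftrightarrow> z m"
proof (cases "z m")
  case True
  then show ?thesis
    using assms ternary_less[of "Suc m" "case_nat b y" "case_nat b z"]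
    by (simp add: agree_case_nat)
next
  case False
  then show ?thesis
    using assms ternary_less[of "Suc m" "case_nat b z" "case_nat b y"]
    by (auto simp: agree_case_nat)
qed

text \<open>Let \<open>p\<close> and \<open>q\<close> first differ at \<open>j\<close>. The two
  copies order them alike if \<open>j\<close> is even and oppositely if \<open>j\<close> is odd, so
  choosing \<open>j\<close> among \<open>m\<close> and \<open>m + 1\<close> achieves any prescribed
  \<open>w\<close>. Only the first \<open>m + 2\<close> digits matter, so nearby points behave the
  same way.\<close>

lemma ex_prescribed_order:
  "\<exists>p\<in>cyl (seg m z). \<exists>q\<in>cyl (seg m z). \<forall>p' q' b.
     seg (m + 2) p' = seg (m + 2) p \<longrightarrow> seg (m + 2) q' = seg (m + 2) q \<longrightarrow>
     p' \<noteq> q' \<and> (ternary (twist b q') < ternary (twist b p') \<longleftrightarrow> w b)"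
proof -
  obtain j where j: "m \<le> j" "j < m + 2" "odd j \<longleftrightarrow> w False \<noteq> w True"
  proof (cases "odd m \<longleftrightarrow> w False \<noteq> w True")
    case True
    then show thesis
      by (intro that[of m]) auto
  next
    case False
    then show thesis
      by (intro that[of "Suc m"]) auto
  qed
  define p q where "p = z(j := w False)" and "q = z(j := \<not> w False)"
  have "p' \<noteq> q' \<and> (ternary (twist b q') < ternary (twist b p') \<longleftrightarrow> w b)"
    if p': "seg (m + 2) p' = seg (m + 2) p" and q': "seg (m + 2) q' = seg (m + 2) q" for p' q' b
  proof -
    have agree: "\<forall>k<j. p' k = q' k"
      using p' q' j by (auto simp: seg_eq_iff p_def q_def)
    have at: "p' j = w False" "q' j = (\<not> w False)"
      using p' q' j by (auto simp: seg_eq_iff p_def q_def)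
    have "ternary (twist b q') < ternary (twist b p') \<longleftrightarrow> (p' j \<noteq> (b \<and> odd j))"
      unfolding twist_def by (rule ternary_case_nat_less_iff) (use agree at in auto)
    also have "\<dots> \<longleftrightarrow> w b"
      using at j by (cases b) auto
    finally show ?thesis
      using at by auto
  qed
  moreover have "p \<in> cyl (seg m z)" "q \<in> cyl (seg m z)"
    using j by (auto simp: p_def q_def mem_cyl_seg)
  ultimately show ?thesis
    by blast
qed

lemma uncountable_fiber:
  fixes g :: "'a \<Rightarrow> 'b :: countable"
  assumes "uncountable F"
  shows "\<exists>v. uncountable {e \<in> F. g e = v}"
proof (rule ccontr)
  assume "\<not> ?thesis"
  then have "countable (\<Union>v. {e \<in> F. g e = v})"
    by blast
  moreover have "(\<Union>v. {e \<in> F. g e = v}) = F"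
    by blast
  ultimately show False
    using assms by simp
qed

context generic_sequence
begin

definition point :: "bool \<Rightarrow> 'i \<Rightarrow> real" where
  "point b r = ternary (twist b (x r))"

lemma point_inject [simp]: "point b r = point d s \<longleftrightarrow> b = d \<and> r = s"
  using inj_x by (simp add: point_def inj_eq)

text \<open>A tuple is split into its indices in decreasing order and a finite pattern
  \<open>p\<close> recording copy and position. As both copies of an index may occur,
  \<open>rs\<close> can be shorter than \<open>e\<close>. Patterns form a countable type and can be
  fixed by pigeonhole.\<close>

lemma tuple_decomposition:
  assumes "set e \<subseteq> range (\<lambda>(b, r). point b r)"
  shows "\<exists>rs p. sorted_wrt (\<lambda>r s. lt s r) rs \<and> e = map (\<lambda>(b, k). point b (rs ! k)) p \<and>
    (\<forall>(b, k)\<in>set p. k < length rs) \<and> (\<forall>r\<in>set rs. \<exists>b. point b r \<in> set e)"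
proof -
  have "\<forall>a\<in>set e. \<exists>br. point (fst br) (snd br) = a"
  proof
    fix a assume "a \<in> set e"
    with assms obtain br where "a = (\<lambda>(b, r). point b r) br"
      by blast
    then show "\<exists>br. point (fst br) (snd br) = a"
      by (auto simp: case_prod_unfold)
  qed
  then have "\<exists>d. \<forall>a\<in>set e. point (fst (d a)) (snd (d a)) = a"
    by (rule bchoice)
  then obtain d where d: "\<And>a. a \<in> set e \<Longrightarrow> point (fst (d a)) (snd (d a)) = a"
    by blast
  define rs where "rs = rev (sorted_list_of_set ((snd \<circ> d) ` set e))"
  have set_rs: "set rs = (snd \<circ> d) ` set e"
    by (simp add: rs_def)
  have "\<forall>a\<in>set e. \<exists>k. k < length rs \<and> rs ! k = snd (d a)"
  proof
    fix a assume "a \<in> set e"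
    then have "snd (d a) \<in> set rs"
      by (simp add: set_rs)
    then show "\<exists>k. k < length rs \<and> rs ! k = snd (d a)"
      by (simp add: in_set_conv_nth)
  qed
  then have "\<exists>K. \<forall>a\<in>set e. K a < length rs \<and> rs ! K a = snd (d a)"
    by (rule bchoice)
  then obtain K where K: "\<And>a. a \<in> set e \<Longrightarrow> K a < length rs \<and> rs ! K a = snd (d a)"
    by blast
  define p where "p = map (\<lambda>a. (fst (d a), K a)) e"
  have "sorted_wrt (\<lambda>r s. lt s r) rs"
    unfolding rs_def sorted_wrt_rev using strict_sorted_list_of_set by simp
  moreover have "e = map (\<lambda>(b, k). point b (rs ! k)) p"
    by (simp add: p_def d K map_idI)
  moreover have "\<forall>(b, k)\<in>set p. k < length rs"
    using K by (auto simp: p_def)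
  moreover have "\<forall>r\<in>set rs. \<exists>b. point b r \<in> set e"
  proof
    fix r assume "r \<in> set rs"
    then obtain a where "a \<in> set e" "r = snd (d a)"
      by (auto simp: set_rs)
    with d[of a] show "\<exists>b. point b r \<in> set e"
      by metis
  qed
  ultimately show ?thesis
    by blast
qed

text \<open>Disjointness allows each point in at most one tuple, and only countably many points have
  index up to \<open>s\<close>.\<close>

lemma countable_tuples_meeting:
  assumes disj: "pairwise (\<lambda>e e'. set e \<inter> set e' = {}) F"
  shows "countable {e \<in> F. \<exists>r b. le r s \<and> point b r \<in> set e}"
proof -
  have "countable {e \<in> F. point b r \<in> set e}" for b r
  proof -
    have unique: "e = e'" if "e \<in> F" "e' \<in> F" "point b r \<in> set e" "point b r \<in> set e'" for e e'
      using disj that by (auto simp: pairwise_def)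
    show ?thesis
    proof (cases "\<exists>e\<in>F. point b r \<in> set e")
      case True
      then obtain e where "e \<in> F" "point b r \<in> set e"
        by blast
      then have "{e \<in> F. point b r \<in> set e} \<subseteq> {e}"
        using unique by blast
      then show ?thesis
        by (rule countable_subset) simp
    next
      case False
      then have "{e \<in> F. point b r \<in> set e} = {}"
        by blast
      then show ?thesis
        by (simp only: countable_empty)
    qed
  qed
  moreover have "countable {r. le r s}"
  proof -
    have "{r. le r s} = insert s {r. lt r s}"
      by auto
    then show ?thesis
      using countable_below by simp
  qed
  ultimately have "countable (\<Union>r\<in>{r. le r s}. \<Union>b. {e \<in> F. point b r \<in> set e})"
    by (intro countable_UN) auto
  moreover have "{e \<in> F. \<exists>r b. le r s \<and> point b r \<in> set e} =
      (\<Union>r\<in>{r. le r s}. \<Union>b. {e \<in> F. point b r \<in> set e})"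
    by blast
  ultimately show ?thesis
    by simp
qed

text \<open>A late tuple of the family is interior to the closure of the index tuples. Two points of
  a box around it that are ordered as \<open>t\<close> demands are then approximated by members of
  the family. This yields \<open>t\<close> itself, not merely \<open>t\<close> or its
  negation.\<close>

lemma ex_tuples_of_type:
  assumes "uncountable F"
    and tuples: "\<And>e. e \<in> F \<Longrightarrow> length e = n \<and> set e \<subseteq> range (\<lambda>(b, r). point b r) \<and> distinct e"
    and disj: "pairwise (\<lambda>e e'. set e \<inter> set e' = {}) F"
    and t: "length t = n" and "n > 0"
  shows "\<exists>e\<in>F. \<exists>e'\<in>F. e \<noteq> e' \<and> tuple_type e e' = t"
proof -
  have "\<forall>e\<in>F. \<exists>rs p. sorted_wrt (\<lambda>r s. lt s r) rs \<and> e = map (\<lambda>(b, k). point b (rs ! k)) p \<and>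
    (\<forall>(b, k)\<in>set p. k < length rs) \<and> (\<forall>r\<in>set rs. \<exists>b. point b r \<in> set e)"
    using tuples tuple_decomposition by blast
  from bchoice[OF this] obtain R where "\<forall>e\<in>F. \<exists>p. sorted_wrt (\<lambda>r s. lt s r) (R e) \<and>
      e = map (\<lambda>(b, k). point b (R e ! k)) p \<and> (\<forall>(b, k)\<in>set p. k < length (R e)) \<and>
      (\<forall>r\<in>set (R e). \<exists>b. point b r \<in> set e)" ..
  from bchoice[OF this] obtain P where RP: "\<forall>e\<in>F. sorted_wrt (\<lambda>r s. lt s r) (R e) \<and>
      e = map (\<lambda>(b, k). point b (R e ! k)) (P e) \<and> (\<forall>(b, k)\<in>set (P e). k < length (R e)) \<and>
      (\<forall>r\<in>set (R e). \<exists>b. point b r \<in> set e)" ..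
  have sorted: "\<And>e. e \<in> F \<Longrightarrow> sorted_wrt (\<lambda>r s. lt s r) (R e)"
    and e_eq: "\<And>e. e \<in> F \<Longrightarrow> e = map (\<lambda>(b, k). point b (R e ! k)) (P e)"
    and P_less: "\<And>e b k. e \<in> F \<Longrightarrow> (b, k) \<in> set (P e) \<Longrightarrow> k < length (R e)"
    and R_meets: "\<And>e r. e \<in> F \<Longrightarrow> r \<in> set (R e) \<Longrightarrow> \<exists>b. point b r \<in> set e"
    using RP by blast+
  \<comment> \<open>Pattern and number of indices take countably many values, so both are constant
    on an uncountable subfamily.\<close>
  obtain v where v: "uncountable {e \<in> F. (P e, length (R e)) = v}"
    using uncountable_fiber[OF assms(1), of "\<lambda>e. (P e, length (R e))"] ..
  obtain p l where pl: "v = (p, l)"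
    by fastforce
  define F' where "F' = {e \<in> F. (P e, length (R e)) = v}"
  have F': "e \<in> F" "P e = p" "length (R e) = l" if "e \<in> F'" for e
    using that by (auto simp: F'_def pl)
  \<comment> \<open>All finite approximations of the index tuples; \<open>tuples_of T\<close> is the
    closure of the family of these tuples.\<close>
  define T where "T = (\<Union>m. (\<lambda>e. map (seg m) (map x (R e))) ` F')"
  obtain s where s: "c s = T"
    using surjD[OF surj_c, of T] by auto
  have "F' \<subseteq> F"
    using F' by blast
  then have "countable {e \<in> F'. \<exists>r b. le r s \<and> point b r \<in> set e}"
    by (intro countable_tuples_meeting pairwise_subset[OF disj])
  moreover have "uncountable F'"
    using v by (simp add: F'_def)
  ultimately have "{e \<in> F'. \<exists>r b. le r s \<and> point b r \<in> set e} \<noteq> F'"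
    by auto
  then obtain e0 where e0: "e0 \<in> F'" "\<And>r b. point b r \<in> set e0 \<Longrightarrow> \<not> le r s"
    by blast
  have "map x (R e0) \<in> tuples_of (c s)"
    using e0(1) by (auto simp: tuples_of_def s T_def)
  moreover have "lt s r" if "r \<in> set (R e0)" for r
  proof -
    obtain b where "point b r \<in> set e0"
      using R_meets[OF F'(1)[OF e0(1)] \<open>r \<in> set (R e0)\<close>] ..
    then show ?thesis
      using e0(2) not_le by blast
  qed
  ultimately obtain m where m: "tuple_box (map (\<lambda>r. cyl (seg m (x r))) (R e0)) \<subseteq> tuples_of T"
    using tuple_box_subset_tuples_of[OF sorted[OF F'(1)[OF e0(1)]], of s] s by blast
  have len_p: "length p = n"
    using tuples[OF F'(1)[OF e0(1)]] arg_cong[OF e_eq[OF F'(1)[OF e0(1)]], of length] F'(2)[OF e0(1)] by simp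
  have "distinct p"
    using tuples[OF F'(1)[OF e0(1)]] e_eq[OF F'(1)[OF e0(1)]] F'(2)[OF e0(1)] by (metis distinct_map)
  \<comment> \<open>The comparison that \<open>t\<close> requires in copy \<open>b\<close> of index
    number \<open>k\<close>. It is well defined because \<open>p\<close> is distinct; pairs outside
    \<open>p\<close> receive an arbitrary value.\<close>
  define w where "w k b = the (map_of (zip p t) (b, k))" for k b
  have w: "w k b = t ! i" if "i < n" "p ! i = (b, k)" for i k b
    using map_of_zip_nth[of p t i] \<open>distinct p\<close> that len_p t by (simp add: w_def)
  define N where "N = m + 2"
  define \<Phi> where "\<Phi> k yz \<longleftrightarrow> fst yz \<in> cyl (seg m (x (R e0 ! k))) \<and> snd yz \<in> cyl (seg m (x (R e0 ! k))) \<and>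
      (\<forall>y z b. seg N y = seg N (fst yz) \<longrightarrow> seg N z = seg N (snd yz) \<longrightarrow>
        y \<noteq> z \<and> (ternary (twist b z) < ternary (twist b y) \<longleftrightarrow> w k b))" for k yz
  have "\<exists>yz. \<Phi> k yz" for k
    using ex_prescribed_order[of m "x (R e0 ! k)" "w k"]
    unfolding \<Phi>_def N_def split_paired_Ex fst_conv snd_conv Bex_def by blast
  then have "\<forall>k. \<exists>yz. \<Phi> k yz" ..
  from choice[OF this] obtain YZ where "\<And>k. \<Phi> k (YZ k)"
    by blast
  then obtain Y Z where Y: "\<And>k. Y k \<in> cyl (seg m (x (R e0 ! k)))"
    and Z: "\<And>k. Z k \<in> cyl (seg m (x (R e0 ! k)))"
    and YZ: "\<And>k y z b. seg N y = seg N (Y k) \<Longrightarrow> seg N z = seg N (Z k) \<Longrightarrow>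
        y \<noteq> z \<and> (ternary (twist b z) < ternary (twist b y) \<longleftrightarrow> w k b)"
    unfolding \<Phi>_def by (intro that[of "fst \<circ> YZ" "snd \<circ> YZ"]) auto
  \<comment> \<open>With no indices every approximation would be the empty list, and the depth
    \<open>N\<close> could not be recovered from it below.\<close>
  have "l > 0"
  proof -
    have "p ! 0 \<in> set p"
      using \<open>n > 0\<close> len_p by simp
    then show ?thesis
      using P_less[OF F'(1)[OF e0(1)], of "fst (p ! 0)" "snd (p ! 0)"] F'(2,3)[OF e0(1)] by simp
  qed
  \<comment> \<open>Every point of the box lies in the closure, hence agrees to depth
    \<open>N\<close> with the indices of some member of \<open>F'\<close>.\<close>
  have approx: "\<exists>e\<in>F'. \<forall>k<l. seg N (x (R e ! k)) = seg N (G k)"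
    if "\<And>k. G k \<in> cyl (seg m (x (R e0 ! k)))" for G
  proof -
    have "map G [0..<l] \<in> tuple_box (map (\<lambda>r. cyl (seg m (x r))) (R e0))"
      using that F'(3)[OF e0(1)] by (auto simp: tuple_box_def list_all2_conv_all_nth)
    then have "map (seg N) (map G [0..<l]) \<in> T"
      using m by (auto simp: tuples_of_def)
    then obtain N' e where e: "e \<in> F'" "map (seg N) (map G [0..<l]) = map (seg N') (map x (R e))"
      by (auto simp: T_def)
    have nth: "seg N (G k) = seg N' (x (R e ! k))" if "k < l" for k
      using arg_cong[OF e(2), of "\<lambda>us. us ! k"] that F'(3)[OF e(1)] by simp
    have "N = N'"
      using nth[OF \<open>l > 0\<close>] by (metis length_seg)
    with nth e(1) show ?thesis
      by (intro bexI[of _ e]) simp_all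
  qed
  obtain e where e: "e \<in> F'" "\<And>k. k < l \<Longrightarrow> seg N (x (R e ! k)) = seg N (Y k)"
    using approx[of Y] Y by blast
  obtain e' where e': "e' \<in> F'" "\<And>k. k < l \<Longrightarrow> seg N (x (R e' ! k)) = seg N (Z k)"
    using approx[of Z] Z by blast
  have len: "length e = n" "length e' = n"
    using tuples F' e e' by auto
  have coord: "e ! i \<noteq> e' ! i \<and> (e' ! i < e ! i \<longleftrightarrow> t ! i)" if "i < n" for i
  proof -
    obtain b k where bk: "p ! i = (b, k)"
      by fastforce
    have "(b, k) \<in> set p"
      using bk that len_p by (metis nth_mem)
    then have "k < l"
      using P_less F' e(1) by blast
    have "d ! i = point b (R d ! k)" if "d \<in> F'" for d
      using arg_cong[OF e_eq[OF F'(1)[OF that]], of "\<lambda>us. us ! i"] F'(2)[OF that] bk \<open>i < n\<close> len_p by simp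
    from this[OF e(1)] this[OF e'(1)] show ?thesis
      using YZ[OF e(2) e'(2), OF \<open>k < l\<close> \<open>k < l\<close>] w[OF that bk] by (auto simp: point_def)
  qed
  have "tuple_type e e' = t"
    using coord len t by (auto simp: tuple_type_def list_eq_iff_nth_eq)
  moreover have "e \<noteq> e'"
    using coord \<open>n > 0\<close> by blast
  ultimately show ?thesis
    using e(1) e'(1) F'(1) by blast
qed

end

subsection \<open>The continuum hypothesis\<close>

text \<open>In a cardinal order proper initial segments have smaller cardinality; under CH this
  means below \<open>aleph1\<close>, hence countable.\<close>

lemma continuum_hypothesis_wellorder:
  assumes "continuum_hypothesis"
  shows "\<exists>le lt :: real \<Rightarrow> real \<Rightarrow> bool. class.linorder le lt \<and> wf {(s, r). lt s r} \<and> (\<forall>r. countable {s. lt s r})"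
proof -
  define R where "R = |UNIV :: real set|"
  have wo: "Well_order R" and co: "Card_order R" and field: "Field R = UNIV"
    unfolding R_def by (rule card_of_Well_order card_of_Card_order Field_card_of)+
  have lin: "Linear_order R"
    using wo by (simp add: well_order_on_def)
  have refl: "(a, a) \<in> R" for a
    using lin field by (auto simp: order_on_defs refl_on_def)
  have trans: "(a, b) \<in> R \<Longrightarrow> (b, d) \<in> R \<Longrightarrow> (a, d) \<in> R" for a b d
    using lin by (meson order_on_defs transE)
  have antisym: "(a, b) \<in> R \<Longrightarrow> (b, a) \<in> R \<Longrightarrow> a = b" for a b
    using lin by (meson order_on_defs antisymD)
  have total: "(a, b) \<in> R \<or> (b, a) \<in> R" for a b
    using lin field refl[of a] by (cases "a = b") (auto simp: order_on_defs total_on_def)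
  have "class.linorder (\<lambda>s r. (s, r) \<in> R) (\<lambda>s r. (s, r) \<in> R - Id)"
    by unfold_locales (use refl trans antisym total in blast)+
  moreover have "wf {(s, r). (s, r) \<in> R - Id}"
  proof -
    have "{(s, r). (s, r) \<in> R - Id} = R - Id"
      by blast
    then show ?thesis
      using wo unfolding well_order_on_def by (simp only:)
  qed
  moreover have "countable {s. (s, r) \<in> R - Id}" for r
  proof -
    have "|underS R r| <o R"
      using card_of_underS[OF co] field by blast
    also have "R =o aleph1"
      using assms by (simp add: continuum_hypothesis_def R_def)
    finally have "|underS R r| \<le>o natLeq"
      unfolding aleph1_def using cardSuc_ordLeq_ordLess[OF natLeq_Card_order card_of_Card_order] by blast
    moreover have "underS R r = {s. (s, r) \<in> R - Id}"
      by (auto simp: underS_def)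
    ultimately show ?thesis
      by (simp add: countable_card_le_natLeq)
  qed
  ultimately show ?thesis
    by blast
qed

text \<open>A subset of a countable type is a binary sequence, and \<open>inv ternary\<close>
  decodes such sequences from reals.\<close>

lemma ex_surj_real: "\<exists>c :: real \<Rightarrow> 'a :: countable set. surj c"
proof -
  have "surj (\<lambda>a. {u. inv ternary a (to_nat (u :: 'a))})"
  proof (rule surjI)
    fix S :: "'a set"
    show "{u. inv ternary (ternary (\<lambda>k. \<exists>u\<in>S. to_nat u = k)) (to_nat u)} = S"
      by (auto simp: inv_f_f[OF inj_ternary])
  qed
  then show ?thesis
    by blast
qed

lemma uncountable_aleph1:
  assumes "|F| =o aleph1"
  shows "uncountable F"
proof
  assume "countable F"
  then have "|F| \<le>o natLeq"
    by (simp add: countable_card_le_natLeq)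
  moreover have "natLeq <o |F|"
    using ordLess_ordIso_trans[OF cardSuc_greater[OF natLeq_Card_order] ordIso_symmetric]
      assms[unfolded aleph1_def] .
  ultimately show False
    using not_ordLess_ordLeq by blast
qed

lemma card_range_aleph1:
  assumes "continuum_hypothesis" and "inj (f :: real \<Rightarrow> 'a)"
  shows "|range f| =o aleph1"
proof -
  have "|range f| =o |UNIV :: real set|"
    using assms(2) by (meson card_of_ordIsoI inj_on_imp_bij_betw ordIso_symmetric)
  then show ?thesis
    using assms(1) unfolding continuum_hypothesis_def by (rule ordIso_transitive)
qed

theorem theorem2:
  assumes "continuum_hypothesis"
  shows "\<exists>(A :: real set) (B :: real set). A homeomorphic B \<and> entangled A \<and> \<not> n_entangled 2 B"
proof -
  obtain le lt :: "real \<Rightarrow> real \<Rightarrow> bool" where lin: "class.linorder le lt"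
    and wo: "wf {(s, r). lt s r}" "\<And>r. countable {s. lt s r}"
    using continuum_hypothesis_wellorder[OF assms] by blast
  obtain c :: "real \<Rightarrow> bool list list set" where c: "surj c"
    using ex_surj_real by blast
  obtain x where "generic_sequence le lt c x"
    using ex_generic_sequence[OF lin wo c] by blast
  then interpret generic_sequence le lt c x .
  define A where "A = range (\<lambda>(b, r). point b r)"
  define untwisted where "untwisted b r = ternary (case_nat b (x r))" for b r
  define B where "B = range (\<lambda>(b, r). untwisted b r)"

  have "range (\<lambda>u. ternary (twist (fst u) (x (snd u)))) homeomorphic
      range (\<lambda>u. ternary (case_nat (fst u) (x (snd u))))"
    by (rule homeomorphic_ternary_images) (rule agree_twist)
  then have "A homeomorphic B"
    by (simp add: A_def B_def point_def untwisted_def case_prod_unfold)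

  moreover have "entangled A"
    unfolding entangled_def n_entangled_def card_entangled_def
  proof (intro allI impI conjI)
    have "aleph1 =o |range (point False)|"
      by (rule ordIso_symmetric, rule card_range_aleph1[OF assms]) (simp add: inj_def)
    moreover have "|range (point False)| \<le>o |A|"
      by (rule card_of_mono1) (auto simp: A_def)
    ultimately show "aleph1 \<le>o |A|"
      by (rule ordIso_ordLeq_trans)
  next
    fix n and F :: "real list set" and t :: "bool list"
    assume "0 < n" and F: "|F| =o aleph1 \<and> (\<forall>e\<in>F. length e = n \<and> set e \<subseteq> A \<and> distinct e) \<and>
        pairwise (\<lambda>e e'. set e \<inter> set e' = {}) F \<and> length t = n"
    then have "\<exists>e\<in>F. \<exists>e'\<in>F. e \<noteq> e' \<and> tuple_type e e' = t"
      by (intro ex_tuples_of_type) (auto simp: A_def uncountable_aleph1)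
    then show "\<exists>e\<in>F. \<exists>e'\<in>F. e \<noteq> e' \<and> realize e e' t"
      unfolding realize_def by blast
  qed

  moreover have "\<not> n_entangled 2 B"
  proof
    assume "n_entangled 2 B"
    \<comment> \<open>Corresponding points of two order-isomorphic copies: both coordinates always
      compare the same way, so neither \<open>[False, True]\<close> nor its negation occurs.\<close>
    define pair where "pair r = [untwisted False r, untwisted True r]" for r
    have inject: "untwisted b r = untwisted d s \<longleftrightarrow> b = d \<and> r = s" for b d r s
    proof
      assume "untwisted b r = untwisted d s"
      then have "case_nat b (x r) = case_nat d (x s)"
        using inj_ternary by (simp add: untwisted_def inj_eq)
      then have "b = d" "x r = x s"
        by (metis old.nat.simps(4), metis (no_types) ext old.nat.simps(5))
      with inj_x show "b = d \<and> r = s"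
        by (simp add: inj_eq)
    qed simp
    have "|range pair| =o aleph1"
      by (rule card_range_aleph1[OF assms]) (simp add: inj_def pair_def inject)
    moreover have "\<forall>e\<in>range pair. length e = 2 \<and> set e \<subseteq> B \<and> distinct e"
      by (force simp: pair_def inject B_def)
    moreover have "pairwise (\<lambda>e e'. set e \<inter> set e' = {}) (range pair)"
      by (auto simp: pairwise_def pair_def inject)
    ultimately have "\<exists>e\<in>range pair. \<exists>e'\<in>range pair. e \<noteq> e' \<and> realize e e' [False, True]"
      using \<open>n_entangled 2 B\<close> unfolding n_entangled_def card_entangled_def
      by (elim conjE allE[of _ "range pair"] allE[of _ "[False, True]"] mp) simp
    then obtain r s where "pair r \<noteq> pair s" and real: "realize (pair r) (pair s) [False, True]"
      by blast
    then have "x r \<noteq> x s"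
      using inj_x by (auto simp: inj_eq)
    then obtain k where "x s k \<noteq> x r k"
      by (auto simp: fun_eq_iff)
    from first_difference[of "x s" k "x r", OF this]
    obtain m where "x s m \<noteq> x r m" "\<forall>k<m. x s k = x r k"
      by (elim exE conjE)
    \<comment> \<open>The right-hand side does not mention \<open>b\<close>: the first difference
      orders both copies alike.\<close>
    then have "untwisted b s < untwisted b r \<longleftrightarrow> x r m" for b
      unfolding untwisted_def by (intro ternary_case_nat_less_iff)
    with real show False
      by (auto simp: realize_def tuple_type_def pair_def)
  qed

  ultimately show ?thesis
    by blast
qed

end
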